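(* Let $n\ge1$. Any $\mathcal{R}$-class of the semigroup $M_n(\mathbb{T})$ consisting of matrices of column generator rank $n$ contains at most one idempotent. Likewise, any $\mathcal{L}$-class of $M_n(\mathbb{T})$ consisting of matrices of row generator rank $n$ contains at most one idempotent.
   Context: $\mathbb{T} = \mathbb{R}\cup\{-\infty\}$ with $a \oplus b = \max(a,b)$ and $a\otimes b = ab = a+b$, where $(-\infty)\oplus x = x$ and $(-\infty)x = x(-\infty)=-\infty$ for all $x$. $M_n(\mathbb{T})$ is the semigroup (monoid) of $n\times n$ matrices over $\mathbb{T}$ under $(AB)_{ij} = \bigoplus_{k=1}^n A_{ik}\otimes B_{kj}$. The column (row) space of a matrix is the $\mathbb{T}$-submodule of $\mathbb{T}^n$ generated by its columns (rows) under componentwise maximum and scaling $(\lambda x)_i=\lambda+x_i$, and the column (row) generator rank is the minimal cardinality of a generating set of the column (row) space. For a semigroup $S$, let $S^1$ be $S$ if $S$ is a monoid, and otherwise $S$ with an identity adjoined. Green's relations: $a\,\mathcal{L}\,b$ iff $S^1a = S^1b$, and $a\,\mathcal{R}\,b$ iff $aS^1 = bS^1$. $\mathcal{L}$-classes and $\mathcal{R}$-classes are the equivalence classes of these relations. *)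

theory Defs
  imports "HOL-Analysis.Analysis"
begin

text \<open>
  The type class operations of \<open>trop\<close> are the tropical ones: \<open>+\<close> is maximum, \<open>*\<close> is
  addition of reals, \<open>0\<close> is $-\infty$ and \<open>1\<close> is the real number $0$. The library's
  matrix product \<open>**\<close>, unit matrix \<open>mat 1\<close> and scalar multiplication \<open>*s\<close>
  over \<open>trop\<close> are therefore the max-plus ones.
\<close>

datatype trop = MInf | Fin real

instantiation trop :: comm_semiring_1
begin

definition zero_trop :: trop where "0 = MInf"

definition one_trop :: trop where "1 = Fin 0"

fun plus_trop :: "trop \<Rightarrow> trop \<Rightarrow> trop" where
  "MInf + y = y"
| "Fin a + MInf = Fin a"
| "Fin a + Fin b = Fin (max a b)"

fun times_trop :: "trop \<Rightarrow> trop \<Rightarrow> trop" where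
  "MInf * y = MInf"
| "Fin a * MInf = MInf"
| "Fin a * Fin b = Fin (a + b)"

instance
proof
  fix a b c :: trop
  show "a + b + c = a + (b + c)" by (cases a; cases b; cases c) auto
  show "a + b = b + a" by (cases a; cases b) auto
  show "0 + a = a" by (simp add: zero_trop_def)
  show "a * b * c = a * (b * c)" by (cases a; cases b; cases c) auto
  show "a * b = b * a" by (cases a; cases b) auto
  show "1 * a = a" by (cases a) (auto simp: one_trop_def)
  show "(a + b) * c = a * c + b * c" by (cases a; cases b; cases c) auto
  show "0 * a = 0" "a * 0 = 0" by (cases a; simp add: zero_trop_def)+
  show "(0::trop) \<noteq> 1" by (simp add: zero_trop_def one_trop_def)
qed

end

definition trop_submodule :: "(trop ^ 'n) set \<Rightarrow> bool" where
  "trop_submodule V \<longleftrightarrow>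
     0 \<in> V \<and> (\<forall>x\<in>V. \<forall>y\<in>V. x + y \<in> V) \<and> (\<forall>c. \<forall>x\<in>V. c *s x \<in> V)"

definition column_space :: "trop ^ 'n ^ 'm \<Rightarrow> (trop ^ 'm) set" where
  "column_space A = trop_submodule hull (columns A)"

definition row_space :: "trop ^ 'n ^ 'm \<Rightarrow> (trop ^ 'n) set" where
  "row_space A = trop_submodule hull (rows A)"

text \<open>
  Only finite generating sets are counted because \<open>card\<close> of an infinite set is \<open>0\<close>;
  column and row spaces are finitely generated by definition.
\<close>

definition generator_rank :: "(trop ^ 'n) set \<Rightarrow> nat" where
  "generator_rank V = (LEAST k. \<exists>G. finite G \<and> card G = k \<and> trop_submodule hull G = V)"

definition column_generator_rank :: "trop ^ 'n ^ 'm \<Rightarrow> nat" where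
  "column_generator_rank A = generator_rank (column_space A)"

definition row_generator_rank :: "trop ^ 'n ^ 'm \<Rightarrow> nat" where
  "row_generator_rank A = generator_rank (row_space A)"

lemma trop_submodule_hull: "trop_submodule (trop_submodule hull G)"
  by (rule hull_in) (auto simp: trop_submodule_def)

text \<open>
  Semigroups are given by an associative operation on a whole type. If there is no identity
  element, the adjoined one contributes exactly the element \<open>a\<close> itself to
  $S^1 a$ and $a S^1$.
\<close>

definition principal_left_ideal :: "('a \<Rightarrow> 'a \<Rightarrow> 'a) \<Rightarrow> 'a \<Rightarrow> 'a set" where
  "principal_left_ideal f a =
     (if \<exists>e. monoid f e then range (\<lambda>x. f x a) else insert a (range (\<lambda>x. f x a)))"

definition principal_right_ideal :: "('a \<Rightarrow> 'a \<Rightarrow> 'a) \<Rightarrow> 'a \<Rightarrow> 'a set" where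
  "principal_right_ideal f a =
     (if \<exists>e. monoid f e then range (\<lambda>x. f a x) else insert a (range (\<lambda>x. f a x)))"

definition green_L :: "('a \<Rightarrow> 'a \<Rightarrow> 'a) \<Rightarrow> 'a rel" where
  "green_L f = {(a, b). principal_left_ideal f a = principal_left_ideal f b}"

definition green_R :: "('a \<Rightarrow> 'a \<Rightarrow> 'a) \<Rightarrow> 'a rel" where
  "green_R f = {(a, b). principal_right_ideal f a = principal_right_ideal f b}"

lemma equiv_green_L: "equiv UNIV (green_L f)"
  by (rule equivI) (auto simp: green_L_def refl_on_def sym_def trans_def)

lemma equiv_green_R: "equiv UNIV (green_R f)"
  by (rule equivI) (auto simp: green_R_def refl_on_def sym_def trans_def)

lemma monoid_matrix_mult: "monoid ((**) :: trop ^ 'n ^ 'n \<Rightarrow> _) (mat 1)"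
  by unfold_locales (simp_all add: matrix_mul_assoc)

end

theory Submission
  imports Defs
begin

text \<open>
  If the columns of \<open>A\<close> form a minimal generating set, then \<open>A ** M = A\<close> forces every diagonal
  entry of \<open>M\<close> to be the tropical unit: otherwise the term of column \<open>j\<close> itself can be dropped
  from the expression of column \<open>j\<close> through the columns of \<open>A\<close>. In particular an idempotent
  of full column generator rank has unit diagonal. Now let \<open>E\<close> and \<open>F\<close> be \<open>\<R>\<close>-related
  idempotents of full column generator rank. Then \<open>F = E ** F\<close>, so \<open>F\<close> dominates \<open>E\<close>
  entrywise because \<open>F\<close> has unit diagonal; by symmetry \<open>E = F\<close>. The statement on
  \<open>\<L>\<close>-classes follows by transposition.
\<close>

text \<open>A maximum equals one of its arguments. For finite \<open>a\<close> the term
  \<open>a * m\<close> differs from \<open>a\<close> because \<open>m\<close> is not the unit, so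
  \<open>r\<close> attains the maximum; for \<open>a = MInf\<close> both terms are
  \<open>MInf\<close>.\<close>

lemma trop_eq_remainder:
  fixes a m r :: trop
  assumes "a = a * m + r" "m \<noteq> 1"
  shows "a = r"
  using assms
  by (cases a; cases m; cases r) (auto simp: one_trop_def max_def split: if_splits)

lemma trop_add_idem: "a + a = (a :: trop)"
  by (cases a) auto

text \<open>Absorption \<open>x + y = y\<close> expresses x \<le> y in the max order.\<close>

lemma trop_sum_absorb:
  fixes f :: "'a \<Rightarrow> trop"
  assumes "finite A" "a \<in> A"
  shows "f a + sum f A = sum f A"
  using assms by (simp add: sum.remove add.assoc[symmetric] trop_add_idem)

lemma trop_submodule_sum:
  assumes "trop_submodule V" "\<And>k. k \<in> K \<Longrightarrow> f k \<in> V"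
  shows "sum f K \<in> V"
  using assms by (induction K rule: infinite_finite_induct) (auto simp: trop_submodule_def)

text \<open>Otherwise fewer than \<open>CARD('n)\<close> columns would generate the column space.
  Removing the index \<open>j\<close> rather than the vector also rules out repeated
  columns.\<close>

lemma column_not_in_hull_of_others:
  fixes A :: "trop ^ 'n ^ 'm"
  assumes "column_generator_rank A = CARD('n)"
  shows "column j A \<notin> trop_submodule hull ((\<lambda>k. column k A) ` (- {j}))"
proof
  let ?G = "(\<lambda>k. column k A) ` (- {j})"
  assume "column j A \<in> trop_submodule hull ?G"
  then have "trop_submodule hull (insert (column j A) ?G) = trop_submodule hull ?G"
    by (rule hull_redundant)
  moreover have "insert (column j A) ?G = columns A"
    by (auto simp: columns_def)
  ultimately have "trop_submodule hull ?G = column_space A"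
    by (simp add: column_space_def)
  then have "column_generator_rank A \<le> card ?G"
    unfolding column_generator_rank_def generator_rank_def
    by (intro Least_le exI[of _ ?G]) auto
  also have "\<dots> \<le> card (- {j})"
    by (rule card_image_le) simp
  also have "\<dots> < CARD('n)"
    by (rule psubset_card_mono) auto
  finally show False
    using assms by simp
qed

lemma diagonal_eq_one_of_right_fixing:
  fixes A :: "trop ^ 'n ^ 'm" and M :: "trop ^ 'n ^ 'n"
  assumes rank: "column_generator_rank A = CARD('n)" and AM: "A ** M = A"
  shows "M $ j $ j = 1"
proof (rule ccontr)
  assume neq: "M $ j $ j \<noteq> 1"
  have "A $ i $ j = (\<Sum>k\<in>-{j}. A $ i $ k * M $ k $ j)" for i
  proof (rule trop_eq_remainder[OF _ neq])
    have "A $ i $ j = (\<Sum>k\<in>UNIV. A $ i $ k * M $ k $ j)"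
      by (subst AM[symmetric]) (simp add: matrix_matrix_mult_def)
    also have "\<dots> = A $ i $ j * M $ j $ j + (\<Sum>k\<in>-{j}. A $ i $ k * M $ k $ j)"
      by (subst sum.remove[of _ j]) (auto simp: Compl_eq_Diff_UNIV)
    finally show "A $ i $ j = A $ i $ j * M $ j $ j + (\<Sum>k\<in>-{j}. A $ i $ k * M $ k $ j)" .
  qed
  \<comment> \<open>The weights \<open>M $ k $ j\<close> do not depend on the row \<open>i\<close>,
    so the entrywise identities form a single linear combination of columns.\<close>
  then have "column j A = (\<Sum>k\<in>-{j}. M $ k $ j *s column k A)"
    by (simp add: vec_eq_iff column_def mult.commute)
  also have "\<dots> \<in> trop_submodule hull ((\<lambda>k. column k A) ` (- {j}))"
  proof (rule trop_submodule_sum[OF trop_submodule_hull])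
    fix k assume "k \<in> - {j}"
    then have "column k A \<in> trop_submodule hull ((\<lambda>k. column k A) ` (- {j}))"
      by (intro hull_inc) auto
    then show "M $ k $ j *s column k A \<in> trop_submodule hull ((\<lambda>k. column k A) ` (- {j}))"
      using trop_submodule_hull unfolding trop_submodule_def by blast
  qed
  finally show False
    using column_not_in_hull_of_others[OF rank] by blast
qed

text \<open>The term \<open>k = j\<close> of the sum defining \<open>(A ** M) $ i $ j\<close> is
  \<open>A $ i $ j\<close> itself.\<close>

lemma entry_absorbed_of_unit_diagonal:
  fixes A :: "trop ^ 'n ^ 'm" and M :: "trop ^ 'n ^ 'n"
  assumes "M $ j $ j = 1"
  shows "A $ i $ j + (A ** M) $ i $ j = (A ** M) $ i $ j"
  using trop_sum_absorb[of UNIV j "\<lambda>k. A $ i $ k * M $ k $ j"] assms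
  by (simp add: matrix_matrix_mult_def)

lemma idempotents_eq_of_column_rank:
  fixes E F :: "trop ^ 'n ^ 'n"
  assumes "E ** E = E" "F ** F = F" "E ** F = F" "F ** E = E"
    and "column_generator_rank E = CARD('n)" "column_generator_rank F = CARD('n)"
  shows "E = F"
proof -
  have "E $ i $ j = F $ i $ j" for i j
  proof -
    have "E $ j $ j = 1" "F $ j $ j = 1"
      using assms by (simp_all add: diagonal_eq_one_of_right_fixing)
    then have "E $ i $ j + F $ i $ j = F $ i $ j" "F $ i $ j + E $ i $ j = E $ i $ j"
      using entry_absorbed_of_unit_diagonal[of F j E i]
        entry_absorbed_of_unit_diagonal[of E j F i] assms(3,4) by simp_all
    then show ?thesis
      \<comment> \<open>Antisymmetry: both absorptions evaluate the same sum.\<close>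
      by (simp add: add.commute)
  qed
  then show ?thesis
    by (simp add: vec_eq_iff)
qed

lemma column_generator_rank_transpose:
  "column_generator_rank (transpose A) = row_generator_rank A"
  by (simp add: column_generator_rank_def row_generator_rank_def column_space_def row_space_def)

text \<open>Transposition reverses products, hence the mirrored mixed products in the
  hypotheses.\<close>

lemma idempotents_eq_of_row_rank:
  fixes E F :: "trop ^ 'n ^ 'n"
  assumes "E ** E = E" "F ** F = F" "E ** F = E" "F ** E = F"
    and "row_generator_rank E = CARD('n)" "row_generator_rank F = CARD('n)"
  shows "E = F"
proof -
  have "transpose E = transpose F"
    by (rule idempotents_eq_of_column_rank)
      (simp_all add: assms matrix_transpose_mul[symmetric] column_generator_rank_transpose)
  then show ?thesis
    by simp
qed

text \<open>An idempotent is a left identity on its principal right ideal: \<open>b = f a x\<close>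
  gives \<open>f a b = f (f a a) x = b\<close>.\<close>

lemma green_R_idempotent_mult:
  assumes "monoid f e" "(a, b) \<in> green_R f" "f a a = a"
  shows "f a b = b"
proof -
  interpret monoid f e by fact
  have "b \<in> range (f b)"
    using right_neutral[of b] by (metis rangeI)
  then have "b \<in> range (f a)"
    using assms(1,2) by (auto simp: green_R_def principal_right_ideal_def split: if_splits)
  then show ?thesis
    by (auto simp: assms(3) assoc[symmetric])
qed

lemma green_L_idempotent_mult:
  assumes "monoid f e" "(a, b) \<in> green_L f" "f a a = a"
  shows "f b a = b"
proof -
  interpret monoid f e by fact
  have "b \<in> range (\<lambda>x. f x b)"
    by (metis left_neutral rangeI)
  then have "b \<in> range (\<lambda>x. f x a)"
    using assms(1,2) by (auto simp: green_L_def principal_left_ideal_def split: if_splits)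
  then show ?thesis
    by (auto simp: assms(3) assoc)
qed

theorem theorem5p7:
  shows "(\<forall>C \<in> UNIV // green_R ((**) :: trop ^ 'n ^ 'n \<Rightarrow> trop ^ 'n ^ 'n \<Rightarrow> trop ^ 'n ^ 'n).
           (\<forall>A\<in>C. column_generator_rank A = CARD('n)) \<longrightarrow>
           (\<exists>\<^sub>\<le>\<^sub>1 E. E \<in> C \<and> E ** E = E)) \<and>
         (\<forall>C \<in> UNIV // green_L ((**) :: trop ^ 'n ^ 'n \<Rightarrow> trop ^ 'n ^ 'n \<Rightarrow> trop ^ 'n ^ 'n).
           (\<forall>A\<in>C. row_generator_rank A = CARD('n)) \<longrightarrow>
           (\<exists>\<^sub>\<le>\<^sub>1 E. E \<in> C \<and> E ** E = E))"
proof (intro conjI ballI impI Uniq_I; elim conjE)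
  fix C and E F :: "trop ^ 'n ^ 'n"
  assume C: "C \<in> UNIV // green_R ((**) :: trop ^ 'n ^ 'n \<Rightarrow> _)" "E \<in> C" "F \<in> C"
    and rank: "\<forall>A\<in>C. column_generator_rank A = CARD('n)"
    and idem: "E ** E = E" "F ** F = F"
  have "(E, F) \<in> green_R (**)" "(F, E) \<in> green_R (**)"
    using quotient_eq_iff[OF equiv_green_R] C by metis+
  then have "E ** F = F" "F ** E = E"
    using green_R_idempotent_mult[OF monoid_matrix_mult] idem by blast+
  then show "E = F"
    using idempotents_eq_of_column_rank idem rank C by blast
next
  fix C and E F :: "trop ^ 'n ^ 'n"
  assume C: "C \<in> UNIV // green_L ((**) :: trop ^ 'n ^ 'n \<Rightarrow> _)" "E \<in> C" "F \<in> C"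
    and rank: "\<forall>A\<in>C. row_generator_rank A = CARD('n)"
    and idem: "E ** E = E" "F ** F = F"
  have "(E, F) \<in> green_L (**)" "(F, E) \<in> green_L (**)"
    using quotient_eq_iff[OF equiv_green_L] C by metis+
  \<comment> \<open>Here idempotents act as right identities, so each product collapses to its left
    factor.\<close>
  then have "E ** F = E" "F ** E = F"
    using green_L_idempotent_mult[OF monoid_matrix_mult] idem by blast+
  then show "E = F"
    using idempotents_eq_of_row_rank idem rank C by blast
qed

end
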